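(* Let $G$ be a group acting on a finite set $X$, and let $\tau\in\mathrm{End}_G(X)$. Then $\tau$ is an elementary collapsing of type $(G_x,[G_y]_{N_{G_x}})$ for some $x,y\in X$ if and only if there exists a fixing elementary collapsing $[x'\mapsto y']$ (with $x',y'\in X$, $G_{x'}\le G_{y'}$, $Gx'\neq Gy'$) such that $\tau\sim_{\mathcal{R}}[x'\mapsto y']$.
   Context: $\mathrm{End}_G(X)$ is the monoid, under composition $(fg)(x)=f(g(x))$, of all $G$-equivariant functions $X\to X$. Write $S=\mathrm{End}_G(X)$. For $a,b\in S$, $a\sim_{\mathcal{R}} b$ means $aS=bS$, where $aS=\{as : s\in S\}$. $G_x$ is the stabilizer and $Gx$ the orbit of $x$. The kernel of $f:X\to X$ is $\ker(f)=\{(x,y)\in X\times X : f(x)=f(y)\}$. For a subgroup $K\le G$ and a subset $N\subseteq G$, $[K]_N=\{n^{-1}Kn : n\in N\}$; $N_H=N_G(H)$ is the normalizer of a subgroup $H\le G$. Definition. For subgroups $H,K\le G$, $\tau\in\mathrm{End}_G(X)$ is an elementary collapsing of type $(H,[K]_{N_H})$ if there exist $x,y\in X$ such that: (i) $Gx\neq Gy$; (ii) $G_x=H$; (iii) $[G_y]_{N_H}=[G_{\tau(x)}]_{N_H}=[K]_{N_H}$; (iv) $\ker(\tau)=\{(a,a): a\in X\}\cup\{(g\cdot x,g\cdot y),(g\cdot y,g\cdot x): g\in G\}\cup\{(g\cdot x,h\cdot x),(h\cdot x,g\cdot x): g,h\in G,\ h^{-1}g\in G_y\}$. It is a fixing elementary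 collapsing if such $x,y$ can be chosen so that additionally $\{t\in X:\tau(t)=t\}=X\setminus Gx$. For $x,y\in X$ with $G_x\le G_y$ and $Gx\ne Gy$, $[x\mapsto y]\in\mathrm{End}_G(X)$ is the function with $[x\mapsto y](g\cdot x)=g\cdot y$ for $g\in G$ and $[x\mapsto y](z)=z$ for $z\notin Gx$; these are fixing elementary collapsings. *)

theory Defs
  imports "HOL-Algebra.Group_Action"
begin

text \<open>
  Functions on the set \<open>X\<close> are represented by extensional functions, as in
  \<^const>\<open>BijGroup\<close>, so that equality of endomorphisms is equality of HOL functions.
\<close>

definition End_G :: "('a, 'c) monoid_scheme \<Rightarrow> 'b set \<Rightarrow> ('a \<Rightarrow> 'b \<Rightarrow> 'b) \<Rightarrow> ('b \<Rightarrow> 'b) monoid"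
  where "End_G G X \<phi> =
    \<lparr>carrier = {f \<in> X \<rightarrow>\<^sub>E X. \<forall>g \<in> carrier G. \<forall>x \<in> X. f (\<phi> g x) = \<phi> g (f x)},
     mult = compose X,
     one = (\<lambda>x \<in> X. x)\<rparr>"

definition Green_R :: "('m, 'c) monoid_scheme \<Rightarrow> 'm \<Rightarrow> 'm \<Rightarrow> bool"
  where "Green_R S a b \<longleftrightarrow>
    a \<in> carrier S \<and> b \<in> carrier S \<and> a <#\<^bsub>S\<^esub> carrier S = b <#\<^bsub>S\<^esub> carrier S"

definition fun_ker :: "'b set \<Rightarrow> ('b \<Rightarrow> 'b) \<Rightarrow> ('b \<times> 'b) set"
  where "fun_ker X f = {(x, y) \<in> X \<times> X. f x = f y}"

definition conj_class :: "('a, 'c) monoid_scheme \<Rightarrow> 'a set \<Rightarrow> 'a set \<Rightarrow> 'a set set"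
  where "conj_class G N K = {inv\<^bsub>G\<^esub> n <#\<^bsub>G\<^esub> K #>\<^bsub>G\<^esub> n | n. n \<in> N}"

text \<open>
  The type of an elementary collapsing is the pair \<open>(H, C)\<close>, where \<open>C\<close> stands for the
  \<open>N\<^sub>G(H)\<close>-conjugacy class of a subgroup. The next predicate says that \<open>x, y\<close> witness that
  \<open>\<tau>\<close> has type \<open>(H, C)\<close>.
\<close>

definition collapsing_witness ::
    "('a, 'c) monoid_scheme \<Rightarrow> 'b set \<Rightarrow> ('a \<Rightarrow> 'b \<Rightarrow> 'b) \<Rightarrow> 'a set \<Rightarrow> 'a set set \<Rightarrow>
     ('b \<Rightarrow> 'b) \<Rightarrow> 'b \<Rightarrow> 'b \<Rightarrow> bool"
  where "collapsing_witness G X \<phi> H C \<tau> x y \<longleftrightarrow>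
    x \<in> X \<and> y \<in> X \<and>
    orbit G \<phi> x \<noteq> orbit G \<phi> y \<and>
    stabilizer G \<phi> x = H \<and>
    conj_class G (normalizer G H) (stabilizer G \<phi> y) = C \<and>
    conj_class G (normalizer G H) (stabilizer G \<phi> (\<tau> x)) = C \<and>
    fun_ker X \<tau> =
      {(a, a) | a. a \<in> X} \<union>
      ({(\<phi> g x, \<phi> g y) | g. g \<in> carrier G} \<union> {(\<phi> g y, \<phi> g x) | g. g \<in> carrier G}) \<union>
      {(\<phi> g x, \<phi> h x) | g h. g \<in> carrier G \<and> h \<in> carrier G \<and>
                               inv\<^bsub>G\<^esub> h \<otimes>\<^bsub>G\<^esub> g \<in> stabilizer G \<phi> y}"

definition elementary_collapsing ::
    "('a, 'c) monoid_scheme \<Rightarrow> 'b set \<Rightarrow> ('a \<Rightarrow> 'b \<Rightarrow> 'b) \<Rightarrow> 'a set \<Rightarrow> 'a set set \<Rightarrow>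
     ('b \<Rightarrow> 'b) \<Rightarrow> bool"
  where "elementary_collapsing G X \<phi> H C \<tau> \<longleftrightarrow>
    \<tau> \<in> carrier (End_G G X \<phi>) \<and> (\<exists>x y. collapsing_witness G X \<phi> H C \<tau> x y)"

definition fixing_elementary_collapsing ::
    "('a, 'c) monoid_scheme \<Rightarrow> 'b set \<Rightarrow> ('a \<Rightarrow> 'b \<Rightarrow> 'b) \<Rightarrow> 'a set \<Rightarrow> 'a set set \<Rightarrow>
     ('b \<Rightarrow> 'b) \<Rightarrow> bool"
  where "fixing_elementary_collapsing G X \<phi> H C \<tau> \<longleftrightarrow>
    \<tau> \<in> carrier (End_G G X \<phi>) \<and>
    (\<exists>x y. collapsing_witness G X \<phi> H C \<tau> x y \<and> {t \<in> X. \<tau> t = t} = X - orbit G \<phi> x)"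

text \<open>
  The function \<open>[x \<mapsto> y]\<close>. The description denotes a unique point as soon as
  \<open>G\<^sub>x \<subseteq> G\<^sub>y\<close>; see \<open>push_orbit_same\<close> below.
\<close>

definition push_orbit ::
    "('a, 'c) monoid_scheme \<Rightarrow> 'b set \<Rightarrow> ('a \<Rightarrow> 'b \<Rightarrow> 'b) \<Rightarrow> 'b \<Rightarrow> 'b \<Rightarrow> 'b \<Rightarrow> 'b"
  where "push_orbit G X \<phi> x y =
    (\<lambda>z \<in> X. if z \<in> orbit G \<phi> x
             then THE w. \<exists>g \<in> carrier G. z = \<phi> g x \<and> w = \<phi> g y
             else z)"

lemma push_orbit_other:
  assumes "z \<in> X" "z \<notin> orbit G \<phi> x"
  shows "push_orbit G X \<phi> x y z = z"
  using assms by (simp add: push_orbit_def)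

lemma (in group_action) push_orbit_same:
  assumes x: "x \<in> E" and y: "y \<in> E"
    and sub: "stabilizer G \<phi> x \<subseteq> stabilizer G \<phi> y" and g: "g \<in> carrier G"
  shows "push_orbit G E \<phi> x y (\<phi> g x) = \<phi> g y"
proof -
  interpret group G using group_hom group_hom.axioms(1) by auto
  have *: "\<phi> h y = \<phi> g y" if h: "h \<in> carrier G" and eq: "\<phi> g x = \<phi> h x" for h
  proof -
    have "\<phi> (inv g \<otimes> h) x = \<phi> (inv g) (\<phi> g x)"
      using x g h by (simp only: composition_rule inv_closed eq)
    also have "\<dots> = x" using orbit_sym_aux[OF g x refl] .
    finally have "inv g \<otimes> h \<in> stabilizer G \<phi> x"
      using g h by (simp add: stabilizer_def)
    then have "\<phi> (inv g \<otimes> h) y = y" using sub by (auto simp: stabilizer_def)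
    then have "\<phi> g y = \<phi> (g \<otimes> (inv g \<otimes> h)) y"
      using g h y by (simp only: composition_rule m_closed inv_closed)
    also have "g \<otimes> (inv g \<otimes> h) = h"
      using g h by (simp add: m_assoc[symmetric])
    finally show ?thesis by simp
  qed
  have "(THE w. \<exists>h \<in> carrier G. \<phi> g x = \<phi> h x \<and> w = \<phi> h y) = \<phi> g y"
    by (rule the_equality) (use g * in blast)+
  moreover have "\<phi> g x \<in> E" using element_image g x by blast
  moreover have "\<phi> g x \<in> orbit G \<phi> x" using g by (auto simp: orbit_def)
  ultimately show ?thesis by (simp add: push_orbit_def)
qed

end

theory Submission
  imports Defs
begin

text \<open>
  If \<open>\<tau>\<close> is an elementary collapsing with witness \<open>x, y\<close>, then \<open>\<tau>\<close> is injective on the invariant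
  set \<open>X - Gx\<close> and already attains its whole image there. Counting orbits, the image is
  \<open>X - Gx'\<close> for some \<open>x'\<close>. Put \<open>y' = \<tau> x'\<close>: equivariance gives \<open>G\<^sub>x\<^sub>' \<le> G\<^sub>y\<^sub>'\<close>, and \<open>y'\<close> lies
  in the image, hence outside \<open>Gx'\<close>. Thus \<open>\<tau>\<close> and \<open>[x' \<mapsto> y']\<close> have the same image, and both
  are injective on an invariant set that maps onto it; partial inverses on these sets show that
  they are \<open>\<R>\<close>-equivalent.

  Conversely, let \<open>[x' \<mapsto> y'] = \<tau> s\<close>. Then \<open>s\<close> is injective on \<open>X - Gx'\<close>, so by the
  same count it maps this set onto some \<open>X - Gx\<close>, and \<open>\<tau>\<close> is a bijection from there onto its image
  \<open>X - Gx'\<close>.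
\<close>

section \<open>Membership in \<open>End_G\<close>, and Green's relation in a monoid\<close>

lemma End_G_carrier:
  "f \<in> carrier (End_G G X \<phi>) \<longleftrightarrow>
    f \<in> X \<rightarrow>\<^sub>E X \<and> (\<forall>g \<in> carrier G. \<forall>x \<in> X. f (\<phi> g x) = \<phi> g (f x))"
  by (simp add: End_G_def)

lemma End_G_closed: "f \<in> carrier (End_G G X \<phi>) \<Longrightarrow> x \<in> X \<Longrightarrow> f x \<in> X"
  by (auto simp: End_G_carrier)

lemma End_G_equivariant:
  "f \<in> carrier (End_G G X \<phi>) \<Longrightarrow> g \<in> carrier G \<Longrightarrow> x \<in> X \<Longrightarrow> f (\<phi> g x) = \<phi> g (f x)"
  by (simp add: End_G_carrier)

lemma End_G_mult: "mult (End_G G X \<phi>) = compose X"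
  by (simp add: End_G_def)

text \<open>Since the identity puts \<open>c\<close> into its own principal right ideal, inclusion
  of the ideal of \<open>c\<close> in that of \<open>d\<close> amounts to \<open>c\<close> being a
  right multiple of \<open>d\<close>. The two inclusions give the two factorizations.\<close>

lemma (in monoid) Green_R_iff:
  "Green_R G a b \<longleftrightarrow> a \<in> carrier G \<and> b \<in> carrier G \<and>
    (\<exists>s \<in> carrier G. b = a \<otimes> s) \<and> (\<exists>t \<in> carrier G. a = b \<otimes> t)"
proof -
  have sub: "c <# carrier G \<subseteq> d <# carrier G \<longleftrightarrow> (\<exists>s \<in> carrier G. c = d \<otimes> s)"
    if c: "c \<in> carrier G" and d: "d \<in> carrier G" for c d
  proof
    have "c \<in> c <# carrier G"
      using r_one[OF c] one_closed unfolding l_coset_def by force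
    moreover assume "c <# carrier G \<subseteq> d <# carrier G"
    ultimately show "\<exists>s \<in> carrier G. c = d \<otimes> s"
      by (auto simp: l_coset_def)
  next
    assume "\<exists>s \<in> carrier G. c = d \<otimes> s"
    then obtain s where s: "s \<in> carrier G" "c = d \<otimes> s" by blast
    have "c \<otimes> u \<in> d <# carrier G" if u: "u \<in> carrier G" for u
      using m_assoc[OF d s(1) u] m_closed[OF s(1) u] s(2) unfolding l_coset_def by auto
    then show "c <# carrier G \<subseteq> d <# carrier G"
      by (auto simp: l_coset_def[of G c])
  qed
  show ?thesis
    unfolding Green_R_def set_eq_subset using sub by blast
qed

section \<open>Orbits, and images and factorizations of endomorphisms\<close>

context group_action
begin

lemma orbit_eq_iff:
  assumes "x \<in> E" "y \<in> E"
  shows "orbit G \<phi> x = orbit G \<phi> y \<longleftrightarrow> y \<in> orbit G \<phi> x"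
proof
  assume "y \<in> orbit G \<phi> x"
  moreover have "orbit G \<phi> x \<in> orbits G E \<phi>" "orbit G \<phi> y \<in> orbits G E \<phi>"
    using assms by (auto simp: orbits_def)
  ultimately show "orbit G \<phi> x = orbit G \<phi> y"
    using disjoint_union orbit_refl[OF assms(2)] by blast
qed (use orbit_refl[OF assms(2)] in blast)

lemma image_mem_orbit: "g \<in> carrier G \<Longrightarrow> \<phi> g x \<in> orbit G \<phi> x"
  by (auto simp: orbit_def)

lemma action_mem_orbit_iff:
  assumes "x \<in> E" "z \<in> E" "g \<in> carrier G"
  shows "\<phi> g z \<in> orbit G \<phi> x \<longleftrightarrow> z \<in> orbit G \<phi> x"
proof -
  have gz: "\<phi> g z \<in> E" using element_image assms by blast
  have "orbit G \<phi> z = orbit G \<phi> (\<phi> g z)"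
    using orbit_eq_iff[OF assms(2) gz] image_mem_orbit[OF assms(3)] by blast
  then show ?thesis
    using orbit_eq_iff[OF assms(1) gz] orbit_eq_iff[OF assms(1,2)] by simp
qed

text \<open>Orbits partition \<open>E\<close>. Written as a union of orbits, the complement has an
  image that can be computed and counted orbit by orbit.\<close>

lemma Diff_orbit:
  assumes "x \<in> E"
  shows "E - orbit G \<phi> x = \<Union> (orbits G E \<phi> - {orbit G \<phi> x})"
proof -
  have "orbit G \<phi> x \<in> orbits G E \<phi>" using assms by (auto simp: orbits_def)
  then have "A = orbit G \<phi> x \<or> A \<inter> orbit G \<phi> x = {}" if "A \<in> orbits G E \<phi>" for A
    using disjoint_union that by blast
  then have "\<Union> (orbits G E \<phi> - {orbit G \<phi> x}) = \<Union> (orbits G E \<phi>) - orbit G \<phi> x"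
    by (intro equalityI subsetI) (fast, auto)
  then show ?thesis by (simp only: orbits_coverture)
qed

lemma End_G_image_orbit:
  assumes "f \<in> carrier (End_G G E \<phi>)" "x \<in> E"
  shows "f ` orbit G \<phi> x = orbit G \<phi> (f x)"
  using End_G_equivariant[OF assms(1)] assms(2) by (force simp: orbit_def)

text \<open>An endomorphism sends orbits onto orbits, and injectivity outside
  \<open>orbit G \<phi> x\<close> keeps the images of the other orbits distinct. So all but one of
  the finitely many orbits are hit, and \<open>x'\<close> is any point of the missed one. This count
  is where finiteness of \<open>E\<close> enters.\<close>

lemma End_G_image_Diff_orbit:
  assumes f: "f \<in> carrier (End_G G E \<phi>)" and fin: "finite E" and x: "x \<in> E"
    and inj: "inj_on f (E - orbit G \<phi> x)"
  shows "\<exists>x' \<in> E. f ` (E - orbit G \<phi> x) = E - orbit G \<phi> x'"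
proof -
  let ?O = "orbits G E \<phi>"
  let ?P = "?O - {orbit G \<phi> x}"
  let ?I = "image f ` ?P"
  have finO: "finite ?O" using fin by (simp add: orbits_def)
  have xO: "orbit G \<phi> x \<in> ?O" using x by (auto simp: orbits_def)
  have "f ` A \<in> ?O" if "A \<in> ?O" for A
    using that End_G_image_orbit[OF f] End_G_closed[OF f] by (fastforce simp: orbits_def)
  then have sub: "?I \<subseteq> ?O" by blast
  have "inj_on (image f) ?P"
    using inj by (intro inj_on_image) (simp only: Diff_orbit[OF x])
  then have "card ?I = card ?O - 1"
    using xO finO by (simp add: card_image)
  moreover have "card ?O > 0" using xO finO card_gt_0_iff by blast
  ultimately have "card (?O - ?I) = 1"
    using sub finO by (simp add: card_Diff_subset finite_subset)
  then obtain A where A: "?O - ?I = {A}" by (rule card_1_singletonE)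
  then have "A \<in> ?O" by blast
  then obtain x' where x': "x' \<in> E" "A = orbit G \<phi> x'" by (auto simp: orbits_def)
  have "?I = ?O - {A}" using A sub by blast
  moreover have "f ` (E - orbit G \<phi> x) = \<Union> ?I"
    by (simp only: Diff_orbit[OF x] image_Union)
  ultimately show ?thesis using Diff_orbit x' by metis
qed

lemma monoid_End_G: "monoid (End_G G E \<phi>)"
proof
  let ?S = "End_G G E \<phi>"
  show "f \<otimes>\<^bsub>?S\<^esub> h \<in> carrier ?S" if "f \<in> carrier ?S" "h \<in> carrier ?S" for f h
    using that element_image End_G_closed[OF that(1)] End_G_closed[OF that(2)]
    by (simp add: End_G_carrier End_G_mult compose_def PiE_iff extensional_def)
  show "f \<otimes>\<^bsub>?S\<^esub> h \<otimes>\<^bsub>?S\<^esub> k = f \<otimes>\<^bsub>?S\<^esub> (h \<otimes>\<^bsub>?S\<^esub> k)"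
    if "f \<in> carrier ?S" "h \<in> carrier ?S" "k \<in> carrier ?S" for f h k
    using End_G_closed[OF that(3)] by (auto simp: End_G_mult compose_def fun_eq_iff)
  show "\<one>\<^bsub>?S\<^esub> \<in> carrier ?S"
    using element_image by (auto simp: End_G_def)
  show "\<one>\<^bsub>?S\<^esub> \<otimes>\<^bsub>?S\<^esub> f = f" if "f \<in> carrier ?S" for f
    using that by (simp add: End_G_def PiE_def Id_compose)
  show "f \<otimes>\<^bsub>?S\<^esub> \<one>\<^bsub>?S\<^esub> = f" if "f \<in> carrier ?S" for f
    using that by (simp add: End_G_def PiE_def compose_Id[where B = E])
qed

text \<open>Lift \<open>h\<close> through \<open>f\<close> by taking the preimage of
  \<open>h z\<close> in \<open>B\<close>. The lift is equivariant because
  \<open>s (\<phi> g z)\<close> and \<open>\<phi> g (s z)\<close> both lie in the invariant set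
  \<open>B\<close> and have the same value under \<open>f\<close>, which is injective there.\<close>

lemma End_G_factor:
  assumes f: "f \<in> carrier (End_G G E \<phi>)" and h: "h \<in> carrier (End_G G E \<phi>)"
    and B: "B \<subseteq> E" "\<And>g b. g \<in> carrier G \<Longrightarrow> b \<in> B \<Longrightarrow> \<phi> g b \<in> B"
    and inj: "inj_on f B" and img: "h ` E \<subseteq> f ` B"
  shows "\<exists>s \<in> carrier (End_G G E \<phi>). h = compose E f s"
proof
  define s where "s = (\<lambda>z \<in> E. inv_into B f (h z))"
  have sB: "s z \<in> B" and fs: "f (s z) = h z" if z: "z \<in> E" for z
  proof -
    have hz: "h z \<in> f ` B" using img z by blast
    show "s z \<in> B" "f (s z) = h z"
      using inv_into_into[OF hz] f_inv_into_f[OF hz] z by (simp_all add: s_def)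
  qed
  have "s (\<phi> g z) = \<phi> g (s z)" if g: "g \<in> carrier G" and z: "z \<in> E" for g z
  proof (rule inj_onD[OF inj])
    have gz: "\<phi> g z \<in> E" using element_image g z by blast
    show "f (s (\<phi> g z)) = f (\<phi> g (s z))"
      using fs[OF gz] fs[OF z] End_G_equivariant[OF h g z]
        End_G_equivariant[OF f g] sB[OF z] B(1) by auto
    show "s (\<phi> g z) \<in> B" using sB gz by blast
    show "\<phi> g (s z) \<in> B" using B(2) g sB z by blast
  qed
  then show "s \<in> carrier (End_G G E \<phi>)"
    using sB B(1) by (auto simp: End_G_carrier s_def)
  show "h = compose E f s"
  proof (rule extensionalityI)
    show "h \<in> extensional E" using h by (simp add: End_G_carrier PiE_def)
    show "compose E f s \<in> extensional E" by (rule compose_extensional)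
    show "h z = compose E f s z" if "z \<in> E" for z
      using fs[OF that] by (simp add: compose_eq[OF that])
  qed
qed

section \<open>The maps [x \<mapsto> y]\<close>

lemma push_orbit_End_G:
  assumes x: "x \<in> E" and y: "y \<in> E" and sub: "stabilizer G \<phi> x \<subseteq> stabilizer G \<phi> y"
  shows "push_orbit G E \<phi> x y \<in> carrier (End_G G E \<phi>)"
proof -
  interpret group G using group_hom group_hom.axioms(1) by auto
  let ?p = "push_orbit G E \<phi> x y"
  have ext: "?p z = undefined" if "z \<notin> E" for z
    using that by (simp add: push_orbit_def)
  have cl: "?p z \<in> E" if z: "z \<in> E" for z
  proof (cases "z \<in> orbit G \<phi> x")
    case True
    then obtain g where g: "g \<in> carrier G" "z = \<phi> g x" by (auto simp: orbit_def)
    show ?thesis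
      using push_orbit_same[OF x y sub g(1)] g element_image[OF g(1) y] by simp
  qed (simp add: push_orbit_other z)
  have "?p (\<phi> g z) = \<phi> g (?p z)" if g: "g \<in> carrier G" and z: "z \<in> E" for g z
  proof (cases "z \<in> orbit G \<phi> x")
    case True
    then obtain h where h: "h \<in> carrier G" "z = \<phi> h x" by (auto simp: orbit_def)
    have "\<phi> g z = \<phi> (g \<otimes> h) x" using composition_rule[OF x g h(1)] h(2) by simp
    then show ?thesis
      using push_orbit_same[OF x y sub] g h composition_rule[OF y g h(1)] by simp
  next
    case False
    then have "\<phi> g z \<notin> orbit G \<phi> x" using action_mem_orbit_iff x z g by blast
    then show ?thesis
      using False z element_image[OF g z] by (simp add: push_orbit_other)
  qed
  then show ?thesis using cl ext by (auto simp: End_G_carrier)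
qed

lemma push_orbit_base:
  assumes "x \<in> E" "y \<in> E" "stabilizer G \<phi> x \<subseteq> stabilizer G \<phi> y"
  shows "push_orbit G E \<phi> x y x = y"
proof -
  interpret group G using group_hom group_hom.axioms(1) by auto
  show ?thesis
    using push_orbit_same[OF assms one_closed] stabilizer_one_closed assms(1,2)
    by (simp add: stabilizer_def)
qed

text \<open>The orbit of \<open>y\<close> is disjoint from that of \<open>x\<close>, so the map is a
  retraction of \<open>E\<close> onto \<open>E - orbit G \<phi> x\<close>; its image and its fixed
  point set therefore agree.\<close>

lemma push_orbit_fixed_points:
  assumes x: "x \<in> E" and y: "y \<in> E" and sub: "stabilizer G \<phi> x \<subseteq> stabilizer G \<phi> y"
    and ne: "orbit G \<phi> x \<noteq> orbit G \<phi> y"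
  shows "{t \<in> E. push_orbit G E \<phi> x y t = t} = E - orbit G \<phi> x"
    and "push_orbit G E \<phi> x y ` E = E - orbit G \<phi> x"
proof -
  let ?p = "push_orbit G E \<phi> x y"
  have img: "?p z \<in> E - orbit G \<phi> x" if z: "z \<in> E" for z
  proof (cases "z \<in> orbit G \<phi> x")
    case True
    then obtain g where g: "g \<in> carrier G" "z = \<phi> g x" by (auto simp: orbit_def)
    have "y \<notin> orbit G \<phi> x" using ne orbit_eq_iff x y by blast
    then have "\<phi> g y \<notin> orbit G \<phi> x" using action_mem_orbit_iff x y g by blast
    then show ?thesis
      using push_orbit_same[OF x y sub g(1)] g(2) element_image[OF g(1) y] by simp
  qed (simp add: push_orbit_other z)
  have fixed: "?p z = z" if "z \<in> E - orbit G \<phi> x" for z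
    using that by (simp add: push_orbit_other)
  show "{t \<in> E. ?p t = t} = E - orbit G \<phi> x" using img fixed by force
  show "?p ` E = E - orbit G \<phi> x" using img fixed by force
qed

section \<open>Elementary collapsings in terms of injectivity\<close>

text \<open>The prescribed kernel says that each \<open>\<phi> g x\<close> is merged with
  \<open>\<phi> g y\<close> and that nothing else happens: the last set in it consists of the
  identifications inside the orbit of \<open>x\<close> that this forces, namely those with
  \<open>\<phi> g y = \<phi> h y\<close>. The condition on the stabilizer of \<open>f x\<close>
  comes from injectivity on the orbit of \<open>y\<close>.\<close>

lemma collapsing_witness_iff:
  assumes f: "f \<in> carrier (End_G G E \<phi>)" and x: "x \<in> E" and y: "y \<in> E"
  shows "collapsing_witness G E \<phi> (stabilizer G \<phi> x)
      (conj_class G (normalizer G (stabilizer G \<phi> x)) (stabilizer G \<phi> y)) f x y \<longleftrightarrow>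
    orbit G \<phi> x \<noteq> orbit G \<phi> y \<and> inj_on f (E - orbit G \<phi> x) \<and> f x = f y"
    (is "?W \<longleftrightarrow> ?R")
proof
  interpret group G using group_hom group_hom.axioms(1) by auto
  let ?K = "{(a, a) | a. a \<in> E} \<union>
      ({(\<phi> g x, \<phi> g y) | g. g \<in> carrier G} \<union> {(\<phi> g y, \<phi> g x) | g. g \<in> carrier G}) \<union>
      {(\<phi> g x, \<phi> h x) | g h. g \<in> carrier G \<and> h \<in> carrier G \<and> inv h \<otimes> g \<in> stabilizer G \<phi> y}"
  {
    assume ?W
    then have ne: "orbit G \<phi> x \<noteq> orbit G \<phi> y" and ker: "fun_ker E f = ?K"
      by (auto simp: collapsing_witness_def)
    have "(\<phi> \<one> x, \<phi> \<one> y) \<in> fun_ker E f" unfolding ker by blast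
    then have "f x = f y"
      using stabilizer_one_closed x y by (simp add: fun_ker_def stabilizer_def)
    moreover have "inj_on f (E - orbit G \<phi> x)"
    proof
      fix a b assume ab: "a \<in> E - orbit G \<phi> x" "b \<in> E - orbit G \<phi> x" "f a = f b"
      \<comment> \<open>Every pair of \<open>?K\<close> off the diagonal has a component in the
        orbit of \<open>x\<close>, so here only the diagonal is left.\<close>
      then have "(a, b) \<in> ?K" using ker by (auto simp: fun_ker_def)
      then show "a = b" using ab image_mem_orbit by auto
    qed
    ultimately show ?R using ne by blast
  }
  {
    assume R: ?R
    then have ne: "orbit G \<phi> x \<noteq> orbit G \<phi> y" and inj: "inj_on f (E - orbit G \<phi> x)"
      and fxy: "f x = f y" by blast+
    have ynx: "y \<notin> orbit G \<phi> x" using ne orbit_eq_iff x y by blast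
    have gy: "\<phi> g y \<in> E - orbit G \<phi> x" if "g \<in> carrier G" for g
      using that ynx action_mem_orbit_iff[OF x y] element_image[OF _ y] by blast
    have fg: "f (\<phi> g x) = f (\<phi> g y)" if "g \<in> carrier G" for g
      using that End_G_equivariant[OF f] x y fxy by simp
    have stab_iff: "inv h \<otimes> g \<in> stabilizer G \<phi> y \<longleftrightarrow> \<phi> g y = \<phi> h y"
      if g: "g \<in> carrier G" and h: "h \<in> carrier G" for g h
    proof -
      have "\<phi> (inv h \<otimes> g) y = \<phi> (inv h) (\<phi> g y)"
        using composition_rule y g h by simp
      moreover have "\<phi> (inv h) (\<phi> g y) = y \<longleftrightarrow> \<phi> g y = \<phi> h y"
      proof
        assume "\<phi> (inv h) (\<phi> g y) = y"
        then have "\<phi> (inv (inv h)) y = \<phi> g y"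
          by (rule orbit_sym_aux[OF inv_closed[OF h] element_image[OF g y refl]])
        then show "\<phi> g y = \<phi> h y" using h by simp
      qed (simp add: orbit_sym_aux[OF h y refl])
      ultimately show ?thesis using g h by (simp add: stabilizer_def)
    qed
    \<comment> \<open>Both \<open>\<phi> g y\<close> and \<open>y\<close> lie outside the orbit of
      \<open>x\<close>, where \<open>f\<close> is injective, so passing from \<open>y\<close> to
      \<open>f y = f x\<close> does not enlarge the stabilizer.\<close>
    have stab: "stabilizer G \<phi> (f x) = stabilizer G \<phi> y"
    proof -
      have "\<phi> g (f y) = f y \<longleftrightarrow> \<phi> g y = y" if g: "g \<in> carrier G" for g
        using End_G_equivariant[OF f g y] inj_onD[OF inj, of "\<phi> g y" y] gy[OF g] y ynx by auto
      then show ?thesis using fxy by (auto simp: stabilizer_def)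
    qed
    have "(a, b) \<in> ?K" if a: "a \<in> E" and b: "b \<in> E" and eq: "f a = f b" for a b
    proof -
      \<comment> \<open>In each case a point \<open>\<phi> g x\<close> is replaced by
        \<open>\<phi> g y\<close>, which has the same value under \<open>f\<close> and lies where
        \<open>f\<close> is injective.\<close>
      consider (nn) "a \<notin> orbit G \<phi> x" "b \<notin> orbit G \<phi> x"
        | (xn) g where "g \<in> carrier G" "a = \<phi> g x" "b \<notin> orbit G \<phi> x"
        | (nx) h where "h \<in> carrier G" "b = \<phi> h x" "a \<notin> orbit G \<phi> x"
        | (xx) g h where "g \<in> carrier G" "a = \<phi> g x" "h \<in> carrier G" "b = \<phi> h x"
        by (auto simp: orbit_def)
      then show ?thesis
      proof cases
        case nn
        then have "a = b" using inj_onD[OF inj eq] a b by blast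
        then show ?thesis using a by blast
      next
        case xn
        then have "\<phi> g y = b" using inj_onD[OF inj, of "\<phi> g y" b] gy fg eq b by auto
        then show ?thesis using xn by blast
      next
        case nx
        then have "\<phi> h y = a" using inj_onD[OF inj, of "\<phi> h y" a] gy fg eq a by auto
        then show ?thesis using nx by blast
      next
        case xx
        then have "\<phi> g y = \<phi> h y" using inj_onD[OF inj, of "\<phi> g y" "\<phi> h y"] gy fg eq by auto
        then show ?thesis using xx stab_iff by blast
      qed
    qed
    moreover have "a \<in> E \<and> b \<in> E \<and> f a = f b" if "(a, b) \<in> ?K" for a b
      using that fg stab_iff element_image[OF _ x refl] element_image[OF _ y refl] by auto
    ultimately have "fun_ker E f = ?K" unfolding fun_ker_def by blast
    then show ?W
      using x y ne stab by (simp add: collapsing_witness_def)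
  }
qed

text \<open>The points defining the type need not be the witnesses of the collapsing. But witnesses
  determine the type, so they can themselves be used to define it.\<close>

lemma elementary_collapsing_iff:
  assumes f: "f \<in> carrier (End_G G E \<phi>)"
  shows "(\<exists>x \<in> E. \<exists>y \<in> E. elementary_collapsing G E \<phi> (stabilizer G \<phi> x)
      (conj_class G (normalizer G (stabilizer G \<phi> x)) (stabilizer G \<phi> y)) f) \<longleftrightarrow>
    (\<exists>x \<in> E. \<exists>y \<in> E. orbit G \<phi> x \<noteq> orbit G \<phi> y \<and> inj_on f (E - orbit G \<phi> x) \<and> f x = f y)"
proof -
  have "collapsing_witness G E \<phi> (stabilizer G \<phi> x)
      (conj_class G (normalizer G (stabilizer G \<phi> x)) (stabilizer G \<phi> y)) f x y"
    if "collapsing_witness G E \<phi> H C f x y" for H C x y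
    using that by (simp add: collapsing_witness_def)
  moreover have "x \<in> E" "y \<in> E" if "collapsing_witness G E \<phi> H C f x y" for H C x y
    using that by (simp_all add: collapsing_witness_def)
  ultimately show ?thesis
    unfolding elementary_collapsing_def using f collapsing_witness_iff[OF f] by meson
qed

text \<open>The map is the identity outside the orbit of \<open>x\<close>, hence injective there,
  and it sends both \<open>x\<close> and \<open>y\<close> to \<open>y\<close>. The criterion for
  collapsing witnesses then applies to \<open>x\<close> and \<open>y\<close>.\<close>

lemma push_orbit_fixing:
  assumes x: "x \<in> E" and y: "y \<in> E" and sub: "stabilizer G \<phi> x \<subseteq> stabilizer G \<phi> y"
    and ne: "orbit G \<phi> x \<noteq> orbit G \<phi> y"
  shows "fixing_elementary_collapsing G E \<phi> (stabilizer G \<phi> x)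
      (conj_class G (normalizer G (stabilizer G \<phi> x)) (stabilizer G \<phi> y))
      (push_orbit G E \<phi> x y)"
proof -
  let ?p = "push_orbit G E \<phi> x y"
  have p: "?p \<in> carrier (End_G G E \<phi>)" by (rule push_orbit_End_G[OF x y sub])
  have "inj_on ?p (E - orbit G \<phi> x)"
    by (auto simp: inj_on_def push_orbit_other)
  moreover have "?p y = y"
    using ne orbit_eq_iff x y by (intro push_orbit_other) blast+
  ultimately show ?thesis
    using p collapsing_witness_iff[OF p x y] push_orbit_base[OF x y sub] ne
      push_orbit_fixed_points(1)[OF x y sub ne]
    unfolding fixing_elementary_collapsing_def by auto
qed

section \<open>Collapsings and Green's relation \<R>\<close>

lemma Green_R_push_orbit_iff:
  assumes fin: "finite E" and f: "f \<in> carrier (End_G G E \<phi>)"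
  shows "(\<exists>x \<in> E. \<exists>y \<in> E.
      orbit G \<phi> x \<noteq> orbit G \<phi> y \<and> inj_on f (E - orbit G \<phi> x) \<and> f x = f y) \<longleftrightarrow>
    (\<exists>x \<in> E. \<exists>y \<in> E. stabilizer G \<phi> x \<subseteq> stabilizer G \<phi> y \<and> orbit G \<phi> x \<noteq> orbit G \<phi> y \<and>
      Green_R (End_G G E \<phi>) f (push_orbit G E \<phi> x y))"
    (is "?L \<longleftrightarrow> ?R")
proof
  let ?S = "End_G G E \<phi>"
  note Green_R_iff = monoid.Green_R_iff[OF monoid_End_G, unfolded End_G_mult]
  {
    assume ?L
    then obtain x y where x: "x \<in> E" and y: "y \<in> E" and ne: "orbit G \<phi> x \<noteq> orbit G \<phi> y"
      and inj: "inj_on f (E - orbit G \<phi> x)" and fxy: "f x = f y" by blast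
    obtain x' where x': "x' \<in> E" and img: "f ` (E - orbit G \<phi> x) = E - orbit G \<phi> x'"
      using End_G_image_Diff_orbit[OF f fin x inj] by blast
    have y_notin: "y \<notin> orbit G \<phi> x" using ne orbit_eq_iff x y by blast
    \<comment> \<open>The values on the orbit of \<open>x\<close> are already taken on the orbit of
      \<open>y\<close>, so the image of all of \<open>E\<close> is that of
      \<open>E - orbit G \<phi> x\<close>.\<close>
    have fE: "f z \<in> E - orbit G \<phi> x'" if z: "z \<in> E" for z
    proof (cases "z \<in> orbit G \<phi> x")
      case True
      then obtain g where g: "g \<in> carrier G" "z = \<phi> g x" by (auto simp: orbit_def)
      have "f z = f (\<phi> g y)" using End_G_equivariant[OF f g(1)] x y g(2) fxy by simp
      moreover have "\<phi> g y \<in> E - orbit G \<phi> x"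
        using action_mem_orbit_iff[OF x y g(1)] element_image[OF g(1) y] y_notin by blast
      ultimately show ?thesis using img by blast
    qed (use img z in blast)
    define y' where "y' = f x'"
    have y': "y' \<in> E" and ne': "orbit G \<phi> x' \<noteq> orbit G \<phi> y'"
      using fE[OF x'] orbit_eq_iff[OF x'] by (auto simp: y'_def)
    have sub: "stabilizer G \<phi> x' \<subseteq> stabilizer G \<phi> y'"
      using End_G_equivariant[OF f _ x'] by (fastforce simp: stabilizer_def y'_def)
    let ?p = "push_orbit G E \<phi> x' y'"
    have p: "?p \<in> carrier ?S" by (rule push_orbit_End_G[OF x' y' sub])
    have pimg: "?p ` E = E - orbit G \<phi> x'"
      by (rule push_orbit_fixed_points(2)[OF x' y' sub ne'])
    have inv: "\<phi> g b \<in> E - orbit G \<phi> u"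
      if "u \<in> E" "g \<in> carrier G" "b \<in> E - orbit G \<phi> u" for u g b
      using that action_mem_orbit_iff element_image by blast
    have "\<exists>s \<in> carrier ?S. ?p = compose E f s"
      by (rule End_G_factor[OF f p Diff_subset[of _ "orbit G \<phi> x"] inv[OF x] inj])
        (use img pimg in auto)
    moreover have "\<exists>s \<in> carrier ?S. f = compose E ?p s"
    proof (rule End_G_factor[OF p f Diff_subset[of _ "orbit G \<phi> x'"] inv[OF x']])
      have id: "?p b = b" if "b \<in> E - orbit G \<phi> x'" for b
        using that by (simp add: push_orbit_other)
      show "inj_on ?p (E - orbit G \<phi> x')" using id by (auto simp: inj_on_def)
      show "f ` E \<subseteq> ?p ` (E - orbit G \<phi> x')" using fE id by force
    qed
    ultimately have "Green_R ?S f ?p" using Green_R_iff f p by blast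
    then show ?R using x' y' sub ne' by blast
  }
  {
    assume ?R
    then obtain x' y' where x': "x' \<in> E" and y': "y' \<in> E"
      and sub: "stabilizer G \<phi> x' \<subseteq> stabilizer G \<phi> y'"
      and ne: "orbit G \<phi> x' \<noteq> orbit G \<phi> y'"
      and R: "Green_R ?S f (push_orbit G E \<phi> x' y')" by blast
    let ?p = "push_orbit G E \<phi> x' y'"
    from R obtain s t where s: "s \<in> carrier ?S" "?p = compose E f s"
      and t: "t \<in> carrier ?S" "f = compose E ?p t"
      unfolding Green_R_iff by blast
    have pimg: "?p ` E = E - orbit G \<phi> x'"
      by (rule push_orbit_fixed_points(2)[OF x' y' sub ne])
    \<comment> \<open>As \<open>?p\<close> fixes these points, the factorization
      \<open>?p = compose E f s\<close> makes \<open>f\<close> a left inverse of \<open>s\<close> on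
      them; both injectivity claims below follow from this.\<close>
    have fs: "f (s z) = z" if "z \<in> E - orbit G \<phi> x'" for z
    proof -
      have "f (s z) = ?p z" using fun_cong[OF s(2), of z] that by (simp add: compose_eq)
      then show ?thesis using that by (simp add: push_orbit_other)
    qed
    then have "inj_on s (E - orbit G \<phi> x')" by (rule inj_on_inverseI)
    then obtain x where x: "x \<in> E" and img: "s ` (E - orbit G \<phi> x') = E - orbit G \<phi> x"
      using End_G_image_Diff_orbit[OF s(1) fin x'] by blast
    have inj: "inj_on f (E - orbit G \<phi> x)"
      unfolding img[symmetric] using fs by (auto simp: inj_on_def)
    \<comment> \<open>From \<open>f = compose E ?p t\<close>, every value of \<open>f\<close> lies
      in the image of \<open>?p\<close>.\<close>
    have "f x \<in> E - orbit G \<phi> x'"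
      using fun_cong[OF t(2), of x] x End_G_closed[OF t(1) x] pimg
      by (metis compose_eq image_eqI)
    \<comment> \<open>The partner of \<open>x\<close> is \<open>s (f x)\<close>: it lies in another
      orbit and has the same value under \<open>f\<close>.\<close>
    then have "s (f x) \<in> E - orbit G \<phi> x" "f x = f (s (f x))"
      using fs img by auto
    then show ?L using x inj orbit_eq_iff by blast
  }
qed

end

theorem lemma30:
  fixes G :: "('a, 'c) monoid_scheme" and X :: "'b set"
    and \<phi> :: "'a \<Rightarrow> 'b \<Rightarrow> 'b" and \<tau> :: "'b \<Rightarrow> 'b"
  assumes "group_action G X \<phi>"
    and "finite X"
    and "\<tau> \<in> carrier (End_G G X \<phi>)"
  shows "(\<exists>x \<in> X. \<exists>y \<in> X.
            elementary_collapsing G X \<phi> (stabilizer G \<phi> x)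
              (conj_class G (normalizer G (stabilizer G \<phi> x)) (stabilizer G \<phi> y)) \<tau>)
     \<longleftrightarrow> (\<exists>x' \<in> X. \<exists>y' \<in> X.
            stabilizer G \<phi> x' \<subseteq> stabilizer G \<phi> y' \<and>
            orbit G \<phi> x' \<noteq> orbit G \<phi> y' \<and>
            fixing_elementary_collapsing G X \<phi> (stabilizer G \<phi> x')
              (conj_class G (normalizer G (stabilizer G \<phi> x')) (stabilizer G \<phi> y'))
              (push_orbit G X \<phi> x' y') \<and>
            Green_R (End_G G X \<phi>) \<tau> (push_orbit G X \<phi> x' y'))"
proof -
  interpret group_action G X \<phi> by fact
  show ?thesis
    unfolding elementary_collapsing_iff[OF assms(3)] Green_R_push_orbit_iff[OF assms(2,3)]
    using push_orbit_fixing by blast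
qed

end
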